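(* Let $s\in\mathbb{N}_+$ and let $f\in C^s[0,1]$ be real-valued. If \[ \lim_{n\to\infty}\|\widehat{B}_n(f)-f\|=0\quad\text{and}\quad\lim_{n\to\infty}\|(\widehat{B}_n(f))^{(s)}-f^{(s)}\|=0, \] then $f^{(i)}(0)\in\mathbb{Z}$ and $f^{(i)}(1)\in\mathbb{Z}$ for $i=0,\dots,s$.
   Context: $\mathbb{N}_+$ is the set of positive integers. $\|\cdot\|$ is the sup-norm on $[0,1]$. $C^s[0,1]$ is the space of real functions with $s$ continuous derivatives on $[0,1]$ (one-sided at the endpoints). For real $\alpha$, $\langle\alpha\rangle$ denotes the nearest integer to $\alpha$, i.e. an integer at which $\min_{m\in\mathbb{Z}}|\alpha-m|$ is attained. When $\alpha=m+1/2$ with $m\in\mathbb{Z}$, $\langle\alpha\rangle$ is $m$ or $m+1$ according to some tie-breaking rule; the result is asserted for any tie-breaking rule (round half up, down, towards zero, away from zero, to even, to odd, random, or any mixture of these). For $f\in C[0,1]$, $n\in\mathbb{N}_+$, $x\in[0,1]$, \[ \widehat{B}_n(f)(x):=\sum_{k=0}^n\left\langle f\left(\frac kn\right)\binom nk\right\rangle x^k(1-x)^{n-k}. \] *)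

theory Defs
  imports "HOL-Analysis.Analysis"
begin

text \<open>Derivatives on \<open>[0,1]\<close> are taken within \<open>[0,1]\<close>, hence one-sided at the endpoints;
  only the values of the function on \<open>[0,1]\<close> matter for them there.\<close>

primrec nth_deriv01 :: "nat \<Rightarrow> (real \<Rightarrow> real) \<Rightarrow> real \<Rightarrow> real" where
  "nth_deriv01 0 f = f"
| "nth_deriv01 (Suc i) f = (\<lambda>x. vector_derivative (nth_deriv01 i f) (at x within {0..1}))"

definition C_diff01 :: "nat \<Rightarrow> (real \<Rightarrow> real) \<Rightarrow> bool" where
  "C_diff01 s f \<longleftrightarrow>
     (\<forall>i<s. nth_deriv01 i f differentiable_on {0..1}) \<and> continuous_on {0..1} (nth_deriv01 s f)"

text \<open>The supremum is the sup-norm only if \<open>g\<close> is bounded on \<open>[0,1]\<close>, in particular if \<open>g\<close> is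
  continuous there.\<close>

definition sup_norm01 :: "(real \<Rightarrow> real) \<Rightarrow> real" where
  "sup_norm01 g = (SUP x\<in>{0..1}. \<bar>g x\<bar>)"

definition nearest_int :: "real \<Rightarrow> int \<Rightarrow> bool" where
  "nearest_int \<alpha> m \<longleftrightarrow> (\<forall>m'::int. \<bar>\<alpha> - of_int m\<bar> \<le> \<bar>\<alpha> - of_int m'\<bar>)"

text \<open>A rounding rule may break ties differently for each degree \<open>n\<close> and index \<open>k\<close>; this covers
  random tie-breaking (each outcome of it is such an \<open>r\<close>) and mixtures of different rules.\<close>

definition rounding_rule :: "(nat \<Rightarrow> nat \<Rightarrow> real \<Rightarrow> int) \<Rightarrow> bool" where
  "rounding_rule r \<longleftrightarrow> (\<forall>n k \<alpha>. nearest_int \<alpha> (r n k \<alpha>))"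

definition Bernstein_int ::
  "(nat \<Rightarrow> nat \<Rightarrow> real \<Rightarrow> int) \<Rightarrow> nat \<Rightarrow> (real \<Rightarrow> real) \<Rightarrow> real \<Rightarrow> real" where
  "Bernstein_int r n f x =
     (\<Sum>k\<le>n. of_int (r n k (f (real k / real n) * real (n choose k))) * x ^ k * (1 - x) ^ (n - k))"

end

theory Submission
  imports Defs "HOL-Computational_Algebra.Polynomial"
begin

text \<open>
  The sums \<open>Bernstein_int r n f\<close> are polynomials with integer coefficients, so all their
  derivatives take integer values at \<open>0\<close> and \<open>1\<close>
  (\<open>Bernstein_int_eq_poly\<close>, \<open>int_coeffs_higher_pderiv\<close>, \<open>poly_in_Ints\<close>). Since \<open>\<int>\<close> is
  closed, it suffices that the \<open>i\<close>-th derivatives of these polynomials converge to those of \<open>f\<close>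
  at the two endpoints, for every \<open>i \<le> s\<close>.

  The hypotheses give convergence only of the functions themselves and of the derivatives of order
  \<open>s\<close>. The orders in between are recovered by \<open>intermediate_derivs_tendsto_0\<close>, applied to the
  differences \<open>Bernstein_int r n f - f\<close>: when a sequence of functions tends to zero pointwise and
  its \<open>s\<close>-th derivatives tend to zero uniformly, the Taylor remainders tend to zero, hence
  so do the Taylor polynomials of degree less than \<open>s\<close>. For polynomials of bounded degree,
  pointwise convergence to zero forces the coefficients to zero
  (\<open>polynomial_coeffs_tendsto_0\<close>), and these coefficients are the derivatives sought, up to fixed
  nonzero factors.
\<close>

section \<open>Derivatives on the unit interval\<close>

lemma has_nth_deriv01:
  assumes "nth_deriv01 i f differentiable_on {0..1}" "x \<in> {0..1}"
  shows "(nth_deriv01 i f has_field_derivative nth_deriv01 (Suc i) f x) (at x within {0..1})"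
  using assms
  by (simp add: has_real_derivative_iff_has_vector_derivative differentiable_on_def
      vector_derivative_works[symmetric])

text \<open>The equality with \<open>poly p\<close> propagates only on \<open>[0,1]\<close>: outside it the filter
  \<open>at x within {0..1}\<close> is trivial and \<open>nth_deriv01\<close> has unspecified values.\<close>

lemma nth_deriv01_poly:
  assumes "\<And>x. x \<in> {0..1} \<Longrightarrow> g x = poly p x" "x \<in> {0..1}"
  shows "nth_deriv01 i g x = poly ((pderiv ^^ i) p) x"
  using assms(2)
proof (induction i arbitrary: x)
  case 0
  then show ?case using assms(1) by simp
next
  case (Suc i)
  have "(poly ((pderiv ^^ i) p) has_real_derivative poly (pderiv ((pderiv ^^ i) p)) x)
        (at x within {0..1})"
    by (rule has_field_derivative_at_within[OF poly_DERIV])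
  then have "(nth_deriv01 i g has_real_derivative poly (pderiv ((pderiv ^^ i) p)) x)
        (at x within {0..1})"
    by (rule has_field_derivative_transform_within[OF _ zero_less_one Suc.prems])
      (simp add: Suc.IH)
  then have "(nth_deriv01 i g has_vector_derivative poly (pderiv ((pderiv ^^ i) p)) x)
        (at x within {0..1})"
    by (simp add: has_real_derivative_iff_has_vector_derivative)
  then show ?case
    using Suc.prems vector_derivative_within_cbox[of 0 1] by simp
qed

lemma abs_le_sup_norm01:
  assumes "continuous_on {0..1} g" "x \<in> {0..1}"
  shows "\<bar>g x\<bar> \<le> sup_norm01 g"
proof -
  have "compact ((\<lambda>x. \<bar>g x\<bar>) ` {0..1})"
    by (intro compact_continuous_image continuous_intros assms) simp
  then have "bdd_above ((\<lambda>x. \<bar>g x\<bar>) ` {0..1})"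
    by (intro bounded_imp_bdd_above compact_imp_bounded)
  then show ?thesis
    unfolding sup_norm01_def by (intro cSUP_upper assms)
qed

section \<open>Convergence of intermediate derivatives\<close>

text \<open>Induction on the number of coefficients. If \<open>q\<close> has degree at most \<open>d\<close>, then
  \<open>q(x) - 2^d q(x/2)\<close> has no term of degree \<open>d\<close>, and each lower coefficient of \<open>q\<close> is multiplied
  by a nonzero constant. Once the lower coefficients tend to zero, evaluating at \<open>1\<close> handles the
  top one. The points \<open>x\<close> and \<open>x/2\<close> both stay in \<open>[0,1]\<close>, which keeps the hypothesis
  stable under the induction.\<close>

lemma polynomial_coeffs_tendsto_0:
  fixes a :: "nat \<Rightarrow> nat \<Rightarrow> real"
  assumes "\<And>x. x \<in> {0..1} \<Longrightarrow> (\<lambda>n. \<Sum>i<d. a n i * x ^ i) \<longlonglongrightarrow> 0" "i < d"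
  shows "(\<lambda>n. a n i) \<longlonglongrightarrow> 0"
  using assms
proof (induction d arbitrary: a i)
  case 0
  then show ?case by simp
next
  case (Suc d)
  have lower: "(\<lambda>n. a n i) \<longlonglongrightarrow> 0" if "i < d" for i
  proof -
    have "(\<lambda>n. a n i * (1 - 2 ^ d / 2 ^ i)) \<longlonglongrightarrow> 0"
    proof (rule Suc.IH[OF _ that])
      fix x :: real assume x: "x \<in> {0..1}"
      have "(\<lambda>n. (\<Sum>i<Suc d. a n i * x ^ i) - 2 ^ d * (\<Sum>i<Suc d. a n i * (x / 2) ^ i))
              \<longlonglongrightarrow> 0 - 2 ^ d * 0"
        using x by (intro tendsto_intros Suc.prems(1)) auto
      moreover have "(\<Sum>i<Suc d. a n i * x ^ i) - 2 ^ d * (\<Sum>i<Suc d. a n i * (x / 2) ^ i)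
          = (\<Sum>i<d. a n i * (1 - 2 ^ d / 2 ^ i) * x ^ i)" for n
        by (simp add: sum_distrib_left distrib_left power_divide sum_subtractf[symmetric] algebra_simps)
      ultimately show "(\<lambda>n. \<Sum>i<d. a n i * (1 - 2 ^ d / 2 ^ i) * x ^ i) \<longlonglongrightarrow> 0"
        by simp
    qed
    moreover have "1 - 2 ^ d / 2 ^ i \<noteq> (0::real)"
      using that by simp
    ultimately show ?thesis
      using tendsto_mult_right_iff[where l = 0] by fastforce
  qed
  have "(\<lambda>n. (\<Sum>i<Suc d. a n i * 1 ^ i) - (\<Sum>i<d. a n i)) \<longlonglongrightarrow> 0 - (\<Sum>i<d. 0)"
    by (intro tendsto_intros Suc.prems(1) lower) auto
  then have "(\<lambda>n. a n d) \<longlonglongrightarrow> 0"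
    by simp
  then show ?case
    using lower Suc.prems(2) by (auto simp: less_Suc_eq)
qed

text \<open>The Taylor polynomial at \<open>w\<close> differs from the function by a multiple of the bound on the
  \<open>s\<close>-th derivative, so it tends to zero near \<open>w\<close>, and its coefficients must do so as well.\<close>

lemma intermediate_derivs_tendsto_0:
  fixes D :: "nat \<Rightarrow> nat \<Rightarrow> real \<Rightarrow> real"
  assumes deriv: "\<And>n i x. i < s \<Longrightarrow> x \<in> {0..1} \<Longrightarrow>
      (D n i has_field_derivative D n (Suc i) x) (at x within {0..1})"
    and lim: "\<And>x. x \<in> {0..1} \<Longrightarrow> (\<lambda>n. D n 0 x) \<longlonglongrightarrow> 0"
    and bound: "\<And>n x. x \<in> {0..1} \<Longrightarrow> \<bar>D n s x\<bar> \<le> B n" and B: "B \<longlonglongrightarrow> 0"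
    and w: "w \<in> {0..1}" and i: "i \<le> s"
  shows "(\<lambda>n. D n i w) \<longlonglongrightarrow> 0"
proof (cases "i = s")
  case True
  have "\<forall>\<^sub>F n in sequentially. norm (D n s w) \<le> B n"
    by (intro always_eventually allI) (simp only: real_norm_def bound[OF w])
  then show ?thesis
    unfolding True by (rule Lim_null_comparison[OF _ B])
next
  case False
  then have "i < s" using i by simp
  then obtain m where s: "s = Suc m" by (cases s) auto
  (* x \<mapsto> w + c * x maps [0,1] into [0,1] and 0 to w, which turns the Taylor polynomial at w into
     a polynomial in x on [0,1], including when w is an endpoint. *)
  define c :: real where "c = (if w \<le> 1/2 then 1/2 else -1/2)"
  have "(\<lambda>n. D n i w * c ^ i / fact i) \<longlonglongrightarrow> 0"
  proof (rule polynomial_coeffs_tendsto_0[OF _ \<open>i < s\<close>])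
    fix x :: real assume x: "x \<in> {0..1}"
    have z: "w + c * x \<in> {0..1}"
      using w x by (auto simp: c_def)
    define T where "T n = (\<Sum>i\<le>m. D n i w * (w + c * x - w) ^ i / fact i)" for n
    have "norm (D n 0 (w + c * x) - T n) \<le> B n * norm (w + c * x - w) ^ Suc m / fact m" for n
      unfolding T_def
      by (rule field_Taylor[where S = "{0..1}"]) (use deriv bound w z s in auto)
    moreover have "(\<lambda>n. B n * norm (w + c * x - w) ^ Suc m / fact m) \<longlonglongrightarrow> 0"
      using B by (auto intro!: tendsto_eq_intros)
    ultimately have "(\<lambda>n. D n 0 (w + c * x) - T n) \<longlonglongrightarrow> 0"
      by (rule Lim_null_comparison[OF always_eventually[OF allI]])
    from tendsto_diff[OF lim[OF z] this] have "T \<longlonglongrightarrow> 0"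
      by simp
    moreover have "T = (\<lambda>n. \<Sum>i<s. D n i w * c ^ i / fact i * x ^ i)"
      by (rule ext) (simp add: T_def s lessThan_Suc_atMost power_mult_distrib mult_ac)
    ultimately show "(\<lambda>n. \<Sum>i<s. D n i w * c ^ i / fact i * x ^ i) \<longlonglongrightarrow> 0"
      by simp
  qed
  then have "(\<lambda>n. D n i w * (c ^ i / fact i)) \<longlonglongrightarrow> 0"
    by simp
  moreover have "c ^ i / fact i \<noteq> 0"
    by (simp add: c_def)
  ultimately show ?thesis
    using tendsto_mult_right_iff[where l = 0] by fastforce
qed

section \<open>Polynomials with integer coefficients\<close>

definition int_coeffs :: "real poly \<Rightarrow> bool" where
  "int_coeffs p \<longleftrightarrow> (\<forall>i. coeff p i \<in> \<int>)"

lemma int_coeffs_mult: "int_coeffs p \<Longrightarrow> int_coeffs q \<Longrightarrow> int_coeffs (p * q)"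
  by (auto simp: int_coeffs_def coeff_mult intro!: Ints_sum Ints_mult)

lemma int_coeffs_power: "int_coeffs p \<Longrightarrow> int_coeffs (p ^ k)"
  by (induction k) (auto simp: int_coeffs_mult, simp add: int_coeffs_def coeff_1)

lemma int_coeffs_sum: "(\<And>k. k \<in> A \<Longrightarrow> int_coeffs (p k)) \<Longrightarrow> int_coeffs (\<Sum>k\<in>A. p k)"
  by (auto simp: int_coeffs_def coeff_sum intro!: Ints_sum)

lemma int_coeffs_pCons: "c \<in> \<int> \<Longrightarrow> int_coeffs p \<Longrightarrow> int_coeffs (pCons c p)"
  by (auto simp: int_coeffs_def coeff_pCons split: nat.split)

lemma int_coeffs_higher_pderiv: "int_coeffs p \<Longrightarrow> int_coeffs ((pderiv ^^ i) p)"
  by (induction i) (auto simp: int_coeffs_def coeff_pderiv simp del: of_nat_Suc intro!: Ints_mult)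

lemma poly_in_Ints: "int_coeffs p \<Longrightarrow> x \<in> \<int> \<Longrightarrow> poly p x \<in> \<int>"
  by (auto simp: int_coeffs_def poly_altdef intro!: Ints_sum Ints_mult Ints_power)

lemma Bernstein_int_eq_poly:
  "\<exists>p. int_coeffs p \<and> Bernstein_int r n f = poly p"
proof (intro exI conjI)
  let ?p = "\<Sum>k\<le>n. [:of_int (r n k (f (real k / real n) * real (n choose k))):]
              * [:0, 1:] ^ k * [:1, -1:] ^ (n - k)"
  have "int_coeffs 0" by (simp add: int_coeffs_def)
  then show "int_coeffs ?p"
    by (intro int_coeffs_sum int_coeffs_mult int_coeffs_power int_coeffs_pCons) auto
  show "Bernstein_int r n f = poly ?p"
    by (rule ext) (simp add: Bernstein_int_def poly_sum mult.assoc)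
qed

section \<open>Integrality of the endpoint derivatives\<close>

theorem mainTheorem5:
  fixes s :: nat
    and f :: "real \<Rightarrow> real"
    and r :: "nat \<Rightarrow> nat \<Rightarrow> real \<Rightarrow> int"
  assumes "s \<ge> 1"
    and "C_diff01 s f"
    and "rounding_rule r"
    and "(\<lambda>n. sup_norm01 (\<lambda>x. Bernstein_int r n f x - f x)) \<longlonglongrightarrow> 0"
    and "(\<lambda>n. sup_norm01 (\<lambda>x. nth_deriv01 s (Bernstein_int r n f) x - nth_deriv01 s f x)) \<longlonglongrightarrow> 0"
  shows "\<forall>i\<le>s. nth_deriv01 i f 0 \<in> \<int> \<and> nth_deriv01 i f 1 \<in> \<int>"
proof -
  have "\<exists>P. \<forall>n. int_coeffs (P n) \<and> Bernstein_int r n f = poly (P n)"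
    by (intro choice allI Bernstein_int_eq_poly)
  then obtain P where "\<forall>n. int_coeffs (P n) \<and> Bernstein_int r n f = poly (P n)" ..
  then have P: "int_coeffs (P n)" "Bernstein_int r n f = poly (P n)" for n
    by simp_all
  have diff: "nth_deriv01 i f differentiable_on {0..1}" if "i < s" for i
    using assms(2) that by (simp add: C_diff01_def)
  define D where "D n i x = poly ((pderiv ^^ i) (P n)) x - nth_deriv01 i f x" for n i x
  have cont: "continuous_on {0..1} (D n i)" if "i \<in> {0, s}" for n i
  proof -
    have "continuous_on {0..1} (nth_deriv01 i f)"
      using that assms(1,2) differentiable_imp_continuous_on[OF diff, of 0]
      by (auto simp: C_diff01_def)
    then show ?thesis
      unfolding D_def by (intro continuous_intros)
  qed
  have sup_norm_D: "sup_norm01 (\<lambda>x. nth_deriv01 i (Bernstein_int r n f) x - nth_deriv01 i f x)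
      = sup_norm01 (D n i)" for n i
    unfolding sup_norm01_def D_def
    by (intro SUP_cong refl) (simp add: nth_deriv01_poly[of _ "P n"] P(2))
  have lim0: "(\<lambda>n. sup_norm01 (D n 0)) \<longlonglongrightarrow> 0"
    using assms(4) sup_norm_D[of 0] by simp
  have lims: "(\<lambda>n. sup_norm01 (D n s)) \<longlonglongrightarrow> 0"
    using assms(5) by (simp only: sup_norm_D)
  have D_lim: "(\<lambda>n. D n i w) \<longlonglongrightarrow> 0" if "i \<le> s" "w \<in> {0..1}" for i w
  proof (rule intermediate_derivs_tendsto_0[OF _ _ _ lims that(2,1)])
    show "(D n i has_field_derivative D n (Suc i) x) (at x within {0..1})"
      if "i < s" "x \<in> {0..1}" for n i x
      unfolding D_def funpow.simps comp_def
      by (intro DERIV_diff has_nth_deriv01 diff that has_field_derivative_at_within[OF poly_DERIV])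
    show "(\<lambda>n. D n 0 x) \<longlonglongrightarrow> 0" if "x \<in> {0..1}" for x
      by (rule Lim_null_comparison[OF _ lim0])
        (use abs_le_sup_norm01[OF cont that] in simp)
    show "\<bar>D n s x\<bar> \<le> sup_norm01 (D n s)" if "x \<in> {0..1}" for n x
      by (rule abs_le_sup_norm01[OF cont that]) simp
  qed
  have "nth_deriv01 i f w \<in> \<int>" if "i \<le> s" "w \<in> {0..1}" "w \<in> \<int>" for i w
  proof -
    have "(\<lambda>n. D n i w + nth_deriv01 i f w) \<longlonglongrightarrow> 0 + nth_deriv01 i f w"
      by (intro tendsto_intros D_lim that)
    then have "(\<lambda>n. poly ((pderiv ^^ i) (P n)) w) \<longlonglongrightarrow> nth_deriv01 i f w"
      by (simp add: D_def)
    then show ?thesis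
      by (rule Lim_in_closed_set[OF closed_Ints _ sequentially_bot, rotated])
        (simp add: poly_in_Ints int_coeffs_higher_pderiv P(1) that(3))
  qed
  then show ?thesis by simp
qed

end
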